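(* There exist admissible shared class constants $(\beta,\bar b,c_-,c_+,\tau,\bar s_0,s_R,s_A)$ and two members $(F_S,K)$, $(F_S',K')$ of the resulting class $\mathcal{M}_{\mathrm{reg}}$ such that $$KF_S=K'F_S'\ \text{ exactly, as Borel laws on }[0,\infty],\qquad\text{yet}\qquad \alpha'=\alpha,\quad L'\ne L,\quad p'_\tau\ne p_\tau,$$ where $(\alpha,L)$ and $(\alpha',L')$ are the A1 parameters of $F_S$ and $F_S'$ and $p_\tau=F_S([0,\tau])$, $p'_\tau=F_S'([0,\tau])$. Consequently, neither $L$ nor $p_\tau$ is identifiable over this $\mathcal{M}_{\mathrm{reg}}$, and neither admits a uniformly consistent estimator over this $\mathcal{M}_{\mathrm{reg}}$.
   Context: A pair $(F_S,K)$ consists of a Borel probability law $F_S$ on $[0,\infty)$ and a Markov kernel $K$ from $[0,\infty)$ to $[0,\infty]$ such that $K([0,\infty)\mid s)>0$ for every $s\ge 0$. Its observed law is the Borel probability $Q=KF_S$ on $[0,\infty]$, $Q(B)=\int_{[0,\infty)}K(B\mid s)\,F_S(ds)$. With $\operatorname{supp}$ the topological support in $[0,\infty]$, put $\ell(s):=\inf(\operatorname{supp}K(\cdot\mid s)\cap[0,\infty))$, $u(s):=\sup(\operatorname{supp}K(\cdot\mid s)\cap[0,\infty))$, $w(s):=u(s)-\ell(s)$, $m(s):=\tfrac12(\ell(s)+u(s))-s$. Admissible shared class constants (common to all members): $\beta\ge 0$, $\bar b<\infty$, $0<c_-\le c_+<\infty$, $\bar s_0>0$, $s_R,s_A\in(0,\bar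 s_0]$, $0<\tau<s_R$. Axioms: A1: $F_S(\{0\})=0$ and there are $s_0\ge\bar s_0$, $L\in(0,\infty)$, $\alpha\in[0,\infty)$ (member-specific) such that $F_S$ has a density $f_S$ on $(0,s_0)$ (a fixed version) with $f_S(s)=Ls^{\alpha}(1+o(1))$ pointwise as $s\downarrow 0$. (The pair $(\alpha,L)$ is uniquely determined by $F_S$.) A2: $w(s)<\infty$ for every $s\ge 0$, and $K(\{+\infty\}\mid s)=0$ for all $s\in[0,s_A]$. A3: $\sup_{s\ge 0}|m(s)|\le\bar b$ and $m\not\equiv 0$. A4: $\lim_{s\downarrow 0}w(s)/s=\infty$. NA: there is no Borel probability $\mu$ on $\mathbb{R}$ such that for $F_S$-a.e. $s$ one has $K(\{+\infty\}\mid s)=0$ and $K(B\mid s)=\mu(B-s)$ for every Borel $B\subseteq[0,\infty)$. A5: the limit $a:=\ell(0+)\in[0,\infty)$ exists and, with the convention $\ell(0):=a$, $c_-(s'-s)\le\ell(s')-\ell(s)\le c_+(s'-s)$ for all $0\le s\le s'\le s_R$, and $\ell$ is nondecreasing on $[0,\infty)$. A6: there is a map $c_K:(0,s_R]\to(0,\infty)$ with $0<\liminf_{s\downarrow 0}c_K(s)\le\limsup_{s\downarrow 0}c_K(s)<\infty$ such that for every $\varepsilon>0$ there is $\eta(\varepsilon)>0$ with $(1-\varepsilon)c_K(s)\delta^{\beta+1}\le K([\ell(s),\ell(s)+\delta]\mid s)\le(1+\varepsilon)c_K(s)\delta^{\beta+1}$ for all $s\in(0,s_R]$, $\delta\in(0,\eta(\varepsilon)]$.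 $\mathcal{M}_{\mathrm{reg}}$ is the set of all pairs satisfying A1--A6 and NA with the given shared constants. A functional $\phi$ of the pair is identifiable over a class $\mathcal{N}$ if for all $(F_S,K),(F_S',K')\in\mathcal{N}$ with $KF_S=K'F_S'$ one has $\phi(F_S,K)=\phi(F_S',K')$. An estimator is a sequence $(\hat\phi_n)_{n\ge 1}$ of Borel maps $\hat\phi_n:[0,\infty]^n\to\mathbb{R}$, evaluated at an i.i.d. sample of size $n$ from $Q=KF_S$ (law $Q^{\otimes n}$). It is uniformly consistent for $\phi$ over $\mathcal{N}$ in risk if $\sup_{(F_S,K)\in\mathcal{N}}\mathbb{E}_{Q^{\otimes n}}|\hat\phi_n-\phi(F_S)|\to 0$, and in probability if $\sup_{(F_S,K)\in\mathcal{N}}\mathbb{P}_{Q^{\otimes n}}(|\hat\phi_n-\phi(F_S)|\ge\varepsilon)\to 0$ for every $\varepsilon>0$; "no uniformly consistent estimator" means none in either sense. *)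

theory Defs
  imports "HOL-Probability.Probability" "HOL-Real_Asymp.Real_Asymp"
begin

text \<open>
  The half-line \<open>[0,\<infinity>)\<close> is the subspace \<open>{0..}\<close> of the reals, the extended half-line \<open>[0,\<infinity>]\<close> is
  the type \<^typ>\<open>ennreal\<close>. The values \<open>K s\<close> of a kernel at \<open>s < 0\<close> are irrelevant.
\<close>

type_synonym law_kernel = "real measure \<times> (real \<Rightarrow> ennreal measure)"

abbreviation half_line :: "real measure" where
  "half_line \<equiv> restrict_space borel {0..}"

definition law_kernel_pair :: "real measure \<Rightarrow> (real \<Rightarrow> ennreal measure) \<Rightarrow> bool" where
  "law_kernel_pair F K \<longleftrightarrow>
     F \<in> space (prob_algebra half_line) \<and>
     K \<in> half_line \<rightarrow>\<^sub>M prob_algebra borel \<and>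
     (\<forall>s\<ge>0. emeasure (K s) {..<\<top>} > 0)"

definition observed_law :: "real measure \<Rightarrow> (real \<Rightarrow> ennreal measure) \<Rightarrow> ennreal measure" where
  "observed_law F K = F \<bind> K"

lemma observed_law_properties:
  assumes "law_kernel_pair F K"
  shows "prob_space (observed_law F K)"
    and "sets (observed_law F K) = sets borel"
    and "B \<in> sets borel \<Longrightarrow> emeasure (observed_law F K) B = (\<integral>\<^sup>+s. emeasure (K s) B \<partial>F)"
proof -
  have F: "F \<in> space (prob_algebra half_line)" and K: "K \<in> half_line \<rightarrow>\<^sub>M prob_algebra borel"
    using assms by (auto simp: law_kernel_pair_def)
  show "prob_space (observed_law F K)" "sets (observed_law F K) = sets borel"
    unfolding observed_law_def using prob_space_bind'[OF F K] sets_bind'[OF F K] by simp_all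
  have sF: "sets F = sets half_line" and pF: "prob_space F"
    using F by (auto simp: space_prob_algebra)
  have "K \<in> F \<rightarrow>\<^sub>M subprob_algebra borel"
    using measurable_prob_algebraD[OF K] measurable_cong_sets[OF sF refl] by auto
  then show "B \<in> sets borel \<Longrightarrow> emeasure (observed_law F K) B = (\<integral>\<^sup>+s. emeasure (K s) B \<partial>F)"
    unfolding observed_law_def
    using emeasure_bind[of F K borel B] prob_space.not_empty[OF pF] by simp
qed


subsection \<open>Support, edges and width\<close>

definition top_support :: "'a::topological_space measure \<Rightarrow> 'a set" where
  "top_support M = {x. \<forall>U. open U \<and> x \<in> U \<longrightarrow> emeasure M U > 0}"

definition lower_edge :: "(real \<Rightarrow> ennreal measure) \<Rightarrow> real \<Rightarrow> ennreal" where
  "lower_edge K s = Inf (top_support (K s) \<inter> {..<\<top>})"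

definition upper_edge :: "(real \<Rightarrow> ennreal measure) \<Rightarrow> real \<Rightarrow> ennreal" where
  "upper_edge K s = Sup (top_support (K s) \<inter> {..<\<top>})"

definition width :: "(real \<Rightarrow> ennreal measure) \<Rightarrow> real \<Rightarrow> ennreal" where
  "width K s = upper_edge K s - lower_edge K s"

text \<open>
  The lower edge is always finite, since \<open>K s\<close> charges \<open>[0,\<infinity>)\<close>, so \<open>ell\<close> is its faithful real
  version. The upper edge is finite exactly when the width is, so \<open>mid_shift\<close> is meaningful
  under \<open>axiom_A2\<close>, in whose presence alone it is used.
\<close>

definition ell :: "(real \<Rightarrow> ennreal measure) \<Rightarrow> real \<Rightarrow> real" where
  "ell K s = enn2real (lower_edge K s)"

definition mid_shift :: "(real \<Rightarrow> ennreal measure) \<Rightarrow> real \<Rightarrow> real" where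
  "mid_shift K s = (enn2real (lower_edge K s) + enn2real (upper_edge K s)) / 2 - s"


subsection \<open>The axioms\<close>

definition density_near_0 :: "real measure \<Rightarrow> real \<Rightarrow> real \<Rightarrow> real \<Rightarrow> bool" where
  "density_near_0 F s0 \<alpha> L \<longleftrightarrow>
     (\<exists>f. f \<in> borel_measurable (restrict_space borel {0<..<s0}) \<and>
          (\<forall>s\<in>{0<..<s0}. 0 \<le> f s) \<and>
          (\<forall>B\<in>sets borel. B \<subseteq> {0<..<s0} \<longrightarrow>
             emeasure F B = (\<integral>\<^sup>+s. ennreal (f s) * indicator B s \<partial>lborel)) \<and>
          ((\<lambda>s. f s / (L * s powr \<alpha>)) \<longlongrightarrow> 1) (at_right 0))"

definition axiom_A1 :: "real \<Rightarrow> real measure \<Rightarrow> bool" where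
  "axiom_A1 sbar F \<longleftrightarrow>
     emeasure F {0} = 0 \<and>
     (\<exists>s0 L \<alpha>. sbar \<le> s0 \<and> 0 < L \<and> 0 \<le> \<alpha> \<and> density_near_0 F s0 \<alpha> L)"

definition axiom_A2 :: "real \<Rightarrow> (real \<Rightarrow> ennreal measure) \<Rightarrow> bool" where
  "axiom_A2 sA K \<longleftrightarrow>
     (\<forall>s\<ge>0. width K s < \<top>) \<and> (\<forall>s\<in>{0..sA}. emeasure (K s) {\<top>} = 0)"

definition axiom_A3 :: "real \<Rightarrow> (real \<Rightarrow> ennreal measure) \<Rightarrow> bool" where
  "axiom_A3 b K \<longleftrightarrow> (\<forall>s\<ge>0. \<bar>mid_shift K s\<bar> \<le> b) \<and> (\<exists>s\<ge>0. mid_shift K s \<noteq> 0)"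

definition axiom_A4 :: "(real \<Rightarrow> ennreal measure) \<Rightarrow> bool" where
  "axiom_A4 K \<longleftrightarrow> ((\<lambda>s. width K s / ennreal s) \<longlongrightarrow> \<top>) (at_right 0)"

definition axiom_NA :: "real measure \<Rightarrow> (real \<Rightarrow> ennreal measure) \<Rightarrow> bool" where
  "axiom_NA F K \<longleftrightarrow>
     \<not> (\<exists>\<mu>\<in>space (prob_algebra (borel :: real measure)).
          AE s in F. emeasure (K s) {\<top>} = 0 \<and>
            (\<forall>B\<in>sets borel. B \<subseteq> {0..} \<longrightarrow>
               emeasure (K s) (ennreal ` B) = emeasure \<mu> ((\<lambda>x. x - s) ` B)))"

text \<open>
  The convention \<open>\<ell>(0) := \<ell>(0+)\<close> is local to this axiom, and applies to both of its parts.
\<close>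

definition axiom_A5 :: "real \<Rightarrow> real \<Rightarrow> real \<Rightarrow> (real \<Rightarrow> ennreal measure) \<Rightarrow> bool" where
  "axiom_A5 cm cp sR K \<longleftrightarrow>
     (\<exists>a\<ge>0. (ell K \<longlongrightarrow> a) (at_right 0) \<and>
        (let l = (ell K)(0 := a) in
           (\<forall>s s'. 0 \<le> s \<and> s \<le> s' \<and> s' \<le> sR \<longrightarrow>
              cm * (s' - s) \<le> l s' - l s \<and> l s' - l s \<le> cp * (s' - s)) \<and>
           mono_on {0..} l))"

definition axiom_A6 :: "real \<Rightarrow> real \<Rightarrow> (real \<Rightarrow> ennreal measure) \<Rightarrow> bool" where
  "axiom_A6 \<beta> sR K \<longleftrightarrow>
     (\<exists>c :: real \<Rightarrow> real.
        (\<forall>s\<in>{0<..sR}. 0 < c s) \<and>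
        0 < Liminf (at_right 0) (\<lambda>s. ereal (c s)) \<and>
        Limsup (at_right 0) (\<lambda>s. ereal (c s)) < \<infinity> \<and>
        (\<forall>\<epsilon>>0. \<exists>\<eta>>0. \<forall>s\<in>{0<..sR}. \<forall>\<delta>\<in>{0<..\<eta>}.
           (1 - \<epsilon>) * c s * \<delta> powr (\<beta> + 1)
             \<le> measure (K s) {ennreal (ell K s)..ennreal (ell K s + \<delta>)} \<and>
           measure (K s) {ennreal (ell K s)..ennreal (ell K s + \<delta>)}
             \<le> (1 + \<epsilon>) * c s * \<delta> powr (\<beta> + 1)))"

definition admissible_constants ::
  "real \<Rightarrow> real \<Rightarrow> real \<Rightarrow> real \<Rightarrow> real \<Rightarrow> real \<Rightarrow> real \<Rightarrow> real \<Rightarrow> bool" where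
  "admissible_constants \<beta> b cm cp \<tau> sbar sR sA \<longleftrightarrow>
     0 \<le> \<beta> \<and> 0 < cm \<and> cm \<le> cp \<and> 0 < sbar \<and> sR \<in> {0<..sbar} \<and> sA \<in> {0<..sbar} \<and>
     0 < \<tau> \<and> \<tau> < sR"

text \<open>No axiom involves \<open>\<tau>\<close>; it is a shared constant only through the functional \<open>p_tau\<close>.\<close>

definition M_reg ::
  "real \<Rightarrow> real \<Rightarrow> real \<Rightarrow> real \<Rightarrow> real \<Rightarrow> real \<Rightarrow> real \<Rightarrow> real \<Rightarrow> law_kernel set" where
  "M_reg \<beta> b cm cp \<tau> sbar sR sA =
     {(F, K). law_kernel_pair F K \<and> axiom_A1 sbar F \<and> axiom_A2 sA K \<and> axiom_A3 b K \<and>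
        axiom_A4 K \<and> axiom_NA F K \<and> axiom_A5 cm cp sR K \<and> axiom_A6 \<beta> sR K}"


subsection \<open>The functionals\<close>

definition leading_params :: "real measure \<Rightarrow> real \<times> real" where
  "leading_params F =
     (THE (\<alpha>, L). 0 \<le> \<alpha> \<and> 0 < L \<and> (\<exists>s0>0. density_near_0 F s0 \<alpha> L))"

definition alpha_of :: "real measure \<Rightarrow> real" where
  "alpha_of F = fst (leading_params F)"

definition L_of :: "real measure \<Rightarrow> real" where
  "L_of F = snd (leading_params F)"

definition p_tau :: "real \<Rightarrow> real measure \<Rightarrow> real" where
  "p_tau \<tau> F = measure F {0..\<tau>}"

lemma density_near_0_unique_aux:
  assumes D: "density_near_0 F s1 \<alpha> L" "density_near_0 F s2 \<alpha>' L'"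
    and pos: "0 < s1" "0 < s2" "0 < L" "0 < L'" and le: "\<alpha> \<le> \<alpha>'"
  shows "\<alpha> = \<alpha>' \<and> L = L'"
proof -
  obtain f where f: "f \<in> borel_measurable (restrict_space borel {0<..<s1})"
      "\<And>B. B \<in> sets borel \<Longrightarrow> B \<subseteq> {0<..<s1} \<Longrightarrow>
         emeasure F B = (\<integral>\<^sup>+s. ennreal (f s) * indicator B s \<partial>lborel)"
      "((\<lambda>s. f s / (L * s powr \<alpha>)) \<longlongrightarrow> 1) (at_right 0)"
      "\<And>s. s \<in> {0<..<s1} \<Longrightarrow> 0 \<le> f s"
    using D(1) unfolding density_near_0_def by blast
  obtain g where g: "g \<in> borel_measurable (restrict_space borel {0<..<s2})"
      "\<And>B. B \<in> sets borel \<Longrightarrow> B \<subseteq> {0<..<s2} \<Longrightarrow>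
         emeasure F B = (\<integral>\<^sup>+s. ennreal (g s) * indicator B s \<partial>lborel)"
      "((\<lambda>s. g s / (L' * s powr \<alpha>')) \<longlongrightarrow> 1) (at_right 0)"
      "\<And>s. s \<in> {0<..<s2} \<Longrightarrow> 0 \<le> g s"
    using D(2) unfolding density_near_0_def by blast
  define t where "t = min s1 s2"
  have t: "t > 0" "t \<le> s1" "t \<le> s2" using pos by (auto simp: t_def)
  define cut where "cut h = (\<lambda>s. ennreal (h s) * indicator {0<..<t} s)" for h :: "real \<Rightarrow> real"
  have meas: "cut h \<in> borel_measurable lborel"
    if h: "h \<in> borel_measurable (restrict_space borel {0<..<r})" and "t \<le> r" for h r
  proof -
    have "h \<in> borel_measurable (restrict_space borel {0<..<t})"
      by (rule measurable_restrict_mono[OF h]) (use \<open>t \<le> r\<close> in auto)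
    then have "(\<lambda>s. ennreal (h s)) \<in> borel_measurable (restrict_space borel {0<..<t})"
      by simp
    then show ?thesis
      by (subst (asm) borel_measurable_restrict_space_iff_ennreal) (auto simp: cut_def)
  qed
  have mf: "cut f \<in> borel_measurable lborel" and mg: "cut g \<in> borel_measurable lborel"
    using meas[OF f(1) t(2)] meas[OF g(1) t(3)] .
  have "density lborel (cut f) = density lborel (cut g)"
  proof (rule measure_eqI)
    fix A assume "A \<in> sets (density lborel (cut f))"
    then have A: "A \<in> sets borel" by simp
    have E: "emeasure (density lborel (cut h)) A =
        (\<integral>\<^sup>+s. ennreal (h s) * indicator (A \<inter> {0<..<t}) s \<partial>lborel)"
      if "cut h \<in> borel_measurable lborel" for h
      using that A by (subst emeasure_density)
        (auto simp: cut_def indicator_def intro!: nn_integral_cong)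
    have AT: "A \<inter> {0<..<t} \<in> sets borel" "A \<inter> {0<..<t} \<subseteq> {0<..<s1}" "A \<inter> {0<..<t} \<subseteq> {0<..<s2}"
      using A t by auto
    show "emeasure (density lborel (cut f)) A = emeasure (density lborel (cut g)) A"
      unfolding E[OF mf] E[OF mg] f(2)[OF AT(1,2), symmetric] g(2)[OF AT(1,3), symmetric] ..
  qed simp
  then have ae: "AE s in lborel. cut f s = cut g s"
    using sigma_finite_measure.density_unique_iff[OF sigma_finite_lborel mf mg] by simp
  have freq: "\<exists>\<^sub>F s in at_right 0. f s = g s"
  proof (rule ccontr)
    assume "\<not> ?thesis"
    then obtain e where e: "e > 0" "\<And>s. 0 < s \<Longrightarrow> s < e \<Longrightarrow> f s \<noteq> g s"
      by (auto simp: frequently_def eventually_at_right_field)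
    define d where "d = min e t"
    have d: "d > 0" using e t by (simp add: d_def)
    have "AE s in lborel. s \<notin> {0<..<d}"
      using ae
    proof eventually_elim
      case (elim s)
      have "f s = g s" if "s \<in> {0<..<d}"
        using elim that f(4)[of s] g(4)[of s] t by (auto simp: cut_def d_def)
      then show ?case using e by (auto simp: d_def)
    qed
    then have "emeasure lborel {0<..<d} = 0"
      by (subst (asm) AE_iff_measurable[of "{0<..<d}"]) auto
    then show False using d by simp
  qed
  define R where "R s = L' / L * s powr (\<alpha>' - \<alpha>)" for s
  define l where "l = (if \<alpha> = \<alpha>' then L' / L else 0)"
  have R: "(R \<longlongrightarrow> l) (at_right 0)"
  proof (cases "\<alpha> = \<alpha>'")
    case True
    have "\<forall>\<^sub>F s in at_right 0. R s = l"
      using eventually_at_right_less[of 0] by eventually_elim (use True in \<open>auto simp: R_def l_def\<close>)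
    then show ?thesis by (rule tendsto_eventually)
  next
    case False
    have "((\<lambda>s. s powr (\<alpha>' - \<alpha>)) \<longlongrightarrow> 0) (at_right (0::real))"
      using le False by real_asymp
    then show ?thesis unfolding R_def l_def
      using False tendsto_mult_right_zero[of _ _ "L' / L"] by simp
  qed
  define q where "q s = (f s / (L * s powr \<alpha>)) / (g s / (L' * s powr \<alpha>'))" for s
  have q: "(q \<longlongrightarrow> 1) (at_right 0)"
    unfolding q_def using tendsto_divide[OF f(3) g(3)] by simp
  have "\<forall>\<^sub>F s in at_right 0. g s / (L' * s powr \<alpha>') > 0"
    using order_tendstoD(1)[OF g(3), of 0] by simp
  then have qR: "\<forall>\<^sub>F s in at_right 0. f s = g s \<longrightarrow> q s = R s"
    using eventually_at_right_less[of 0]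
    by eventually_elim (use pos in \<open>auto simp: q_def R_def powr_diff field_simps\<close>)
  have "l = 1"
  proof (rule ccontr)
    assume "l \<noteq> 1"
    then have "\<forall>\<^sub>F s in at_right 0. q s - R s \<noteq> 0"
      using tendsto_diff[OF q R] by (intro tendsto_imp_eventually_ne[of _ "1 - l"]) auto
    with qR have "\<forall>\<^sub>F s in at_right 0. f s \<noteq> g s"
      by eventually_elim auto
    with freq show False by (simp add: frequently_def)
  qed
  then show ?thesis using pos by (auto simp: l_def split: if_splits)
qed

lemma leading_params_eq:
  assumes "density_near_0 F s0 \<alpha> L" "0 < s0" "0 < L" "0 \<le> \<alpha>"
  shows "leading_params F = (\<alpha>, L)" "alpha_of F = \<alpha>" "L_of F = L"
proof -
  show *: "leading_params F = (\<alpha>, L)"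
    unfolding leading_params_def
  proof (rule the_equality)
    show "case (\<alpha>, L) of (\<alpha>, L) \<Rightarrow> 0 \<le> \<alpha> \<and> 0 < L \<and> (\<exists>s0>0. density_near_0 F s0 \<alpha> L)"
      using assms by auto
  next
    fix p :: "real \<times> real"
    assume "case p of (\<alpha>, L) \<Rightarrow> 0 \<le> \<alpha> \<and> 0 < L \<and> (\<exists>s0>0. density_near_0 F s0 \<alpha> L)"
    then obtain a M s where p: "p = (a, M)" "0 < M" "0 < s" "density_near_0 F s a M"
      by (cases p) auto
    show "p = (\<alpha>, L)"
      using density_near_0_unique_aux[of F s a M s0 \<alpha> L]
        density_near_0_unique_aux[of F s0 \<alpha> L s a M] p assms by (cases "a \<le> \<alpha>") auto
  qed
  show "alpha_of F = \<alpha>" "L_of F = L" by (simp_all add: alpha_of_def L_of_def *)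
qed


subsection \<open>Identifiability and estimation\<close>

definition identifiable :: "law_kernel set \<Rightarrow> (law_kernel \<Rightarrow> real) \<Rightarrow> bool" where
  "identifiable N \<phi> \<longleftrightarrow>
     (\<forall>(F, K)\<in>N. \<forall>(F', K')\<in>N. observed_law F K = observed_law F' K' \<longrightarrow> \<phi> (F, K) = \<phi> (F', K'))"

definition sample_law :: "nat \<Rightarrow> ennreal measure \<Rightarrow> (nat \<Rightarrow> ennreal) measure" where
  "sample_law n Q = PiM {..<n} (\<lambda>_. Q)"

definition estimator :: "(nat \<Rightarrow> (nat \<Rightarrow> ennreal) \<Rightarrow> real) \<Rightarrow> bool" where
  "estimator est \<longleftrightarrow> (\<forall>n\<ge>1. est n \<in> borel_measurable (PiM {..<n} (\<lambda>_. borel)))"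

definition consistent_in_risk ::
  "law_kernel set \<Rightarrow> (law_kernel \<Rightarrow> real) \<Rightarrow> (nat \<Rightarrow> (nat \<Rightarrow> ennreal) \<Rightarrow> real) \<Rightarrow> bool" where
  "consistent_in_risk N \<phi> est \<longleftrightarrow>
     (\<lambda>n. SUP (F, K)\<in>N.
        \<integral>\<^sup>+x. ennreal \<bar>est n x - \<phi> (F, K)\<bar> \<partial>sample_law n (observed_law F K)) \<longlonglongrightarrow> 0"

definition consistent_in_probability ::
  "law_kernel set \<Rightarrow> (law_kernel \<Rightarrow> real) \<Rightarrow> (nat \<Rightarrow> (nat \<Rightarrow> ennreal) \<Rightarrow> real) \<Rightarrow> bool" where
  "consistent_in_probability N \<phi> est \<longleftrightarrow>
     (\<forall>\<epsilon>>0.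
       (\<lambda>n. SUP (F, K)\<in>N.
          emeasure (sample_law n (observed_law F K))
            {x \<in> space (sample_law n (observed_law F K)). \<epsilon> \<le> \<bar>est n x - \<phi> (F, K)\<bar>})
       \<longlonglongrightarrow> 0)"

definition no_uniformly_consistent_estimator ::
  "law_kernel set \<Rightarrow> (law_kernel \<Rightarrow> real) \<Rightarrow> bool" where
  "no_uniformly_consistent_estimator N \<phi> \<longleftrightarrow>
     \<not> (\<exists>est. estimator est \<and> consistent_in_risk N \<phi> est) \<and>
     \<not> (\<exists>est. estimator est \<and> consistent_in_probability N \<phi> est)"

end

theory Submission
  imports Defs
begin

text \<open>
  The kernel at \<open>s\<close> mixes Lebesgue measure on \<open>[s, s + 1]\<close>, with weight \<open>c(s)\<close>, and an atom of mass
  \<open>1 - c(s)\<close> at the upper edge, which sits at \<open>3\<close> for every \<open>s \<le> 1\<close>. If the latent law has density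
  \<open>f\<close> on \<open>[0, 1]\<close>, the observed law depends on \<open>f\<close> and \<open>c\<close> only through \<open>f c\<close>, since the atom at \<open>3\<close>
  just collects the remaining mass. As \<open>A6\<close> leaves the edge constant \<open>c\<close> free, \<open>f\<close> may be tilted and
  \<open>c = 1 / (4 f)\<close> compensates exactly. Estimators cannot tell two such members apart, so
  Le Cam's two-point argument excludes uniform consistency.
\<close>

section \<open>The mixing kernel: mass formula and edges\<close>

text \<open>
  The mixture is realised as the image of a uniform variable \<open>u\<close>, which makes the joint measurability
  immediate: the part \<open>u \<le> c(s)\<close> is stretched over \<open>[s, s + 1]\<close>, the rest goes to the atom.
\<close>
definition kern :: "(real \<Rightarrow> real) \<Rightarrow> real \<Rightarrow> ennreal measure" where
  "kern c s = distr (uniform_measure lborel {0..1}) borel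
     (\<lambda>u. ennreal (if u \<le> c s then s + u / c s else max 3 (s + 2)))"

lemma prob_space_uniform_01: "prob_space (uniform_measure lborel {0..1::real})"
  by (rule prob_space_uniform_measure) auto

lemma sets_kern [simp]: "sets (kern c s) = sets borel"
  by (simp add: kern_def)

lemma measurable_kern:
  assumes [measurable]: "c \<in> borel_measurable borel"
  shows "kern c \<in> half_line \<rightarrow>\<^sub>M prob_algebra borel"
proof -
  have [measurable]: "(\<lambda>s::real. uniform_measure lborel {0..1::real}) \<in> borel \<rightarrow>\<^sub>M prob_algebra borel"
    by (rule measurable_const) (simp add: space_prob_algebra prob_space_uniform_01)
  have "kern c \<in> borel \<rightarrow>\<^sub>M prob_algebra borel"
    unfolding kern_def by measurable
  then show ?thesis by (rule measurable_restrict_space1)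
qed

text \<open>Substituting \<open>u = c s * x\<close> on the part \<open>u \<le> c s\<close> produces
  the factor \<open>c s\<close> and a variable \<open>x\<close> uniform on \<open>[0, 1]\<close>;
  the remaining \<open>u\<close> have length \<open>1 - c s\<close> and all go to the upper
  atom.\<close>

lemma emeasure_kern:
  assumes B [measurable]: "B \<in> sets borel" and c: "0 < c s" "c s \<le> 1"
  shows "emeasure (kern c s) B =
    ennreal (c s) * (\<integral>\<^sup>+x. indicator {0..1} x * indicator B (ennreal (s + x)) \<partial>lborel)
    + ennreal (1 - c s) * indicator B (ennreal (max 3 (s + 2)))"
proof -
  define g where "g u = ennreal (if u \<le> c s then s + u / c s else max 3 (s + 2))" for u
  have [measurable]: "g \<in> borel_measurable borel" unfolding g_def by measurable
  have "emeasure (kern c s) B = emeasure lborel ({0..1} \<inter> g -` B)"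
    unfolding kern_def g_def[symmetric]
    by (subst emeasure_distr)
       (use measurable_sets[of g borel borel B] in \<open>auto simp: divide_ennreal_def\<close>)
  also have "\<dots> = (\<integral>\<^sup>+u. indicator ({0..1} \<inter> g -` B) u \<partial>lborel)"
    by (rule nn_integral_indicator[symmetric]) (use measurable_sets[of g borel borel B] in auto)
  also have "\<dots> = (\<integral>\<^sup>+u. indicator {0..c s} u * indicator B (ennreal (s + u / c s))
      + indicator {c s<..1} u * indicator B (ennreal (max 3 (s + 2))) \<partial>lborel)"
    by (rule nn_integral_cong) (use c in \<open>auto simp: indicator_def g_def\<close>)
  also have "\<dots> = (\<integral>\<^sup>+u. indicator {0..c s} u * indicator B (ennreal (s + u / c s)) \<partial>lborel)
      + (\<integral>\<^sup>+u. indicator {c s<..1} u * indicator B (ennreal (max 3 (s + 2))) \<partial>lborel)"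
    by (rule nn_integral_add) measurable
  also have "(\<integral>\<^sup>+u. indicator {0..c s} u * indicator B (ennreal (s + u / c s)) \<partial>lborel)
      = ennreal (c s) * (\<integral>\<^sup>+x. indicator {0..1} x * indicator B (ennreal (s + x)) \<partial>lborel)"
    by (subst nn_integral_real_affine[where c="c s" and t=0])
       (use c in \<open>auto simp: indicator_def zero_le_mult_iff intro!: arg_cong2[where f="(*)"] nn_integral_cong\<close>)
  also have "(\<integral>\<^sup>+u. indicator {c s<..1} u * indicator B (ennreal (max 3 (s + 2))) \<partial>lborel)
      = ennreal (1 - c s) * indicator B (ennreal (max 3 (s + 2)))"
    by (subst nn_integral_multc) (use c in auto)
  finally show ?thesis .
qed

text \<open>For \<open>\<delta> \<le> 1\<close> the atom lies strictly above
  \<open>s + \<delta>\<close>, so only the uniform part contributes. This exact linearity in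
  \<delta> later gives \<open>axiom_A6\<close> with \<open>\<beta> = 0\<close>.\<close>

lemma emeasure_kern_initial:
  assumes c: "0 < c s" "c s \<le> 1" and s: "0 \<le> s" and \<delta>: "0 \<le> \<delta>" "\<delta> \<le> 1"
  shows "emeasure (kern c s) {ennreal s..ennreal (s + \<delta>)} = ennreal (c s * \<delta>)"
proof -
  have "(\<integral>\<^sup>+x. indicator {0..1} x * indicator {ennreal s..ennreal (s + \<delta>)} (ennreal (s + x)) \<partial>lborel)
      = (\<integral>\<^sup>+x. indicator {0..\<delta>} x \<partial>lborel)"
    by (rule nn_integral_cong) (use s \<delta> in \<open>auto simp: indicator_def\<close>)
  also have "\<dots> = ennreal \<delta>" using \<delta> by simp
  finally have I: "(\<integral>\<^sup>+x. indicator {0..1} x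
      * indicator {ennreal s..ennreal (s + \<delta>)} (ennreal (s + x)) \<partial>lborel) = ennreal \<delta>" .
  have "s + \<delta> < max 3 (s + 2)" using \<delta> by simp
  then have "\<not> ennreal (max 3 (s + 2)) \<le> ennreal (s + \<delta>)"
    using s \<delta> by (simp add: ennreal_le_iff2 del: ennreal_plus)
  then show ?thesis
    using c \<delta> by (subst emeasure_kern) (simp_all add: I ennreal_mult del: ennreal_plus)
qed

lemma emeasure_kern_top_finite:
  assumes c: "0 < c s" "c s \<le> 1" and s: "0 \<le> s"
  shows "emeasure (kern c s) {\<top>} = 0" "emeasure (kern c s) {..<\<top>} > 0"
proof -
  show "emeasure (kern c s) {\<top>} = 0"
    using c s by (subst emeasure_kern) auto
  have "0 < emeasure (kern c s) {ennreal s..ennreal (s + 1)}"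
    using emeasure_kern_initial[of c s 1] c s by simp
  also have "\<dots> \<le> emeasure (kern c s) {..<\<top>}"
    by (rule emeasure_mono) (auto intro: le_less_trans)
  finally show "emeasure (kern c s) {..<\<top>} > 0" .
qed

text \<open>The complement of \<open>[s, b]\<close> is open and null. Both end points are in the
  support: every neighbourhood of \<open>s\<close> contains a short initial interval, and the strict
  bound \<open>c s < 1\<close> leaves the atom at \<open>b\<close> positive mass.\<close>

lemma kern_edges:
  assumes c: "0 < c s" "c s < 1" and s: "0 \<le> s"
  shows "lower_edge (kern c) s = ennreal s" and "upper_edge (kern c) s = ennreal (max 3 (s + 2))"
proof -
  define b where "b = max 3 (s + 2)"
  have le: "c s \<le> 1" and sb: "s + 1 \<le> b" "0 \<le> b" using c s by (auto simp: b_def)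
  let ?S = "top_support (kern c s) \<inter> {..<\<top>}"
  have sub: "?S \<subseteq> {ennreal s..ennreal b}"
  proof
    fix y assume y: "y \<in> ?S"
    let ?U = "- {ennreal s..ennreal b}"
    have zero: "emeasure (kern c s) ?U = 0"
    proof -
      have "(\<integral>\<^sup>+x. indicator {0..1} x * indicator ?U (ennreal (s + x)) \<partial>lborel) = (\<integral>\<^sup>+(x::real). 0 \<partial>lborel)"
        by (rule nn_integral_cong) (use s sb in \<open>auto simp: indicator_def\<close>)
      then show ?thesis
        using c le s sb by (subst emeasure_kern) (auto simp: b_def[symmetric] intro!: ennreal_leI)
    qed
    show "y \<in> {ennreal s..ennreal b}"
    proof (rule ccontr)
      assume "y \<notin> {ennreal s..ennreal b}"
      then have "0 < emeasure (kern c s) ?U"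
        using y unfolding top_support_def by (auto simp: open_Compl)
      with zero show False by simp
    qed
  qed
  have sin: "ennreal s \<in> ?S"
  proof -
    have "emeasure (kern c s) U > 0" if U: "open U" "ennreal s \<in> U" for U
    proof -
      have "((\<lambda>x. ennreal (s + x)) \<longlongrightarrow> ennreal (s + 0)) (at_right 0)"
        by (intro tendsto_intros)
      then have "\<forall>\<^sub>F x in at_right 0. ennreal (s + x) \<in> U"
        using U by (intro topological_tendstoD) auto
      then obtain e where e: "e > 0" "\<And>x. 0 < x \<Longrightarrow> x < e \<Longrightarrow> ennreal (s + x) \<in> U"
        by (auto simp: eventually_at_right_field)
      \<comment> \<open>The bound by 1 makes \<open>emeasure_kern_initial\<close> applicable;
        halving \<open>e\<close> keeps the closed interval inside the open range that maps into
        \<open>U\<close>.\<close>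
      define \<delta> where "\<delta> = min 1 (e / 2)"
      have \<delta>: "0 < \<delta>" "\<delta> \<le> 1" "\<delta> < e" using e by (auto simp: \<delta>_def)
      have "{ennreal s..ennreal (s + \<delta>)} \<subseteq> U"
      proof
        fix y assume y: "y \<in> {ennreal s..ennreal (s + \<delta>)}"
        then have "y < \<top>" by (auto intro: le_less_trans)
        then obtain r where r: "y = ennreal r" "0 \<le> r" by (cases y) auto
        with y s \<delta> have "s \<le> r" "r \<le> s + \<delta>" by (auto simp del: ennreal_plus)
        with e(2)[of "r - s"] U r \<delta> show "y \<in> U" by (cases "r = s") auto
      qed
      then have "emeasure (kern c s) {ennreal s..ennreal (s + \<delta>)} \<le> emeasure (kern c s) U"
        by (rule emeasure_mono) (use U in auto)
      moreover have "emeasure (kern c s) {ennreal s..ennreal (s + \<delta>)} > 0"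
        using emeasure_kern_initial[of c s \<delta>] c le s \<delta> by simp
      ultimately show ?thesis by (rule less_le_trans[rotated])
    qed
    then show ?thesis by (auto simp: top_support_def)
  qed
  have bin: "ennreal b \<in> ?S"
  proof -
    have "emeasure (kern c s) U > 0" if U: "open U" "ennreal b \<in> U" for U
      using U c le by (subst emeasure_kern) (auto simp: b_def[symmetric] add_pos_nonneg add_nonneg_pos)
    then show ?thesis by (auto simp: top_support_def)
  qed
  show "lower_edge (kern c) s = ennreal s" "upper_edge (kern c) s = ennreal (max 3 (s + 2))"
    unfolding lower_edge_def upper_edge_def b_def[symmetric]
    using sub sin bin by (auto intro!: cInf_eq_minimum cSup_eq_maximum)
qed

section \<open>Le Cam's two-point argument for equal observed laws\<close>

text \<open>Since the observed laws coincide, the errors at both parameter values are taken under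
  the same sample law \<open>P n\<close>. By the triangle inequality they add up to at least
  \<open>d\<close>, so the worst-case error cannot tend to 0.\<close>

lemma two_point_no_estimator:
  assumes mem: "(F, K) \<in> N" "(F', K') \<in> N" and pair: "law_kernel_pair F K"
    and obs: "observed_law F K = observed_law F' K'" and ne: "\<phi> (F, K) \<noteq> \<phi> (F', K')"
  shows "no_uniformly_consistent_estimator N \<phi>"
proof -
  define Q where "Q = observed_law F K"
  define P where "P n = sample_law n Q" for n
  define d where "d = \<bar>\<phi> (F, K) - \<phi> (F', K')\<bar>"
  have d: "d > 0" using ne by (simp add: d_def)
  interpret Q: prob_space Q unfolding Q_def by (rule observed_law_properties[OF pair])
  have sQ [measurable_cong]: "sets Q = sets borel"
    unfolding Q_def by (rule observed_law_properties[OF pair])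
  have prob: "prob_space (P n)" for n
    unfolding P_def sample_law_def by (rule prob_space_PiM) (rule Q.prob_space_axioms)
  have meas: "est n \<in> borel_measurable (P n)" if "estimator est" "n \<ge> 1" for est n
    using that unfolding estimator_def P_def sample_law_def
    by (subst measurable_cong_sets[OF sets_PiM_cong[OF refl sQ] refl]) auto
  \<comment> \<open>Here \<open>X n\<close> stands for the worst-case error over \<open>N\<close>,
    counted once for each of the two members.\<close>
  have contra: False
    if lim: "X \<longlonglongrightarrow> 0" and "b > 0" and ge: "\<And>n. n \<ge> 1 \<Longrightarrow> b \<le> X n + X n"
    for X :: "nat \<Rightarrow> ennreal" and b
  proof -
    have "(\<lambda>n. X n + X n) \<longlonglongrightarrow> 0 + 0" by (intro tendsto_add lim)
    then have "b \<le> 0 + 0"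
      by (rule tendsto_lowerbound) (use ge in \<open>auto simp: eventually_sequentially\<close>)
    then show False using \<open>b > 0\<close> by simp
  qed
  have "\<not> consistent_in_risk N \<phi> est" if est: "estimator est" for est
  proof
    assume cons: "consistent_in_risk N \<phi> est"
    let ?R = "\<lambda>n (F, K). \<integral>\<^sup>+x. ennreal \<bar>est n x - \<phi> (F, K)\<bar> \<partial>sample_law n (observed_law F K)"
    show False
    proof (rule contra[OF cons[unfolded consistent_in_risk_def], of "ennreal d"])
      fix n :: nat assume n: "n \<ge> 1"
      interpret P: prob_space "P n" by (rule prob)
      note [measurable] = meas[OF est n]
      have "ennreal d = (\<integral>\<^sup>+x. ennreal d \<partial>P n)" by (simp add: P.emeasure_space_1)
      also have "\<dots> \<le> (\<integral>\<^sup>+x. ennreal \<bar>est n x - \<phi> (F, K)\<bar> + ennreal \<bar>est n x - \<phi> (F', K')\<bar> \<partial>P n)"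
        by (rule nn_integral_mono) (simp add: d_def flip: ennreal_plus)
      also have "\<dots> = (\<integral>\<^sup>+x. ennreal \<bar>est n x - \<phi> (F, K)\<bar> \<partial>P n)
          + (\<integral>\<^sup>+x. ennreal \<bar>est n x - \<phi> (F', K')\<bar> \<partial>P n)"
        by (rule nn_integral_add) measurable
      also have "\<dots> = ?R n (F, K) + ?R n (F', K')"
        by (simp add: P_def Q_def obs)
      also have "\<dots> \<le> (SUP p\<in>N. ?R n p) + (SUP p\<in>N. ?R n p)"
        by (intro add_mono SUP_upper mem)
      finally show "ennreal d \<le> (SUP p\<in>N. ?R n p) + (SUP p\<in>N. ?R n p)" .
    qed (use d in auto)
  qed
  moreover have "\<not> consistent_in_probability N \<phi> est" if est: "estimator est" for est
  proof
    assume cons: "consistent_in_probability N \<phi> est"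
    \<comment> \<open>No real number is closer than \<open>d / 2\<close> to both parameter values,
      so at this threshold the two error events cover the sample space.\<close>
    let ?R = "\<lambda>n (F, K). emeasure (sample_law n (observed_law F K))
            {x \<in> space (sample_law n (observed_law F K)). d / 2 \<le> \<bar>est n x - \<phi> (F, K)\<bar>}"
    have lim: "(\<lambda>n. SUP p\<in>N. ?R n p) \<longlonglongrightarrow> 0"
      by (rule cons[unfolded consistent_in_probability_def, rule_format]) (use d in simp)
    show False
    proof (rule contra[OF lim, of 1])
      fix n :: nat assume n: "n \<ge> 1"
      interpret P: prob_space "P n" by (rule prob)
      note [measurable] = meas[OF est n]
      let ?E = "\<lambda>p. {x \<in> space (P n). d / 2 \<le> \<bar>est n x - \<phi> p\<bar>}"
      have "1 = emeasure (P n) (space (P n))" by (simp add: P.emeasure_space_1)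
      also have "\<dots> \<le> emeasure (P n) (?E (F, K) \<union> ?E (F', K'))"
        by (rule emeasure_mono) (auto simp: d_def abs_if field_simps split: if_splits)
      also have "\<dots> \<le> emeasure (P n) (?E (F, K)) + emeasure (P n) (?E (F', K'))"
        by (rule emeasure_subadditive) measurable
      also have "\<dots> = ?R n (F, K) + ?R n (F', K')"
        by (simp add: P_def Q_def obs)
      also have "\<dots> \<le> (SUP p\<in>N. ?R n p) + (SUP p\<in>N. ?R n p)"
        by (intro add_mono SUP_upper mem)
      finally show "1 \<le> (SUP p\<in>N. ?R n p) + (SUP p\<in>N. ?R n p)" .
    qed simp
  qed
  ultimately show ?thesis by (auto simp: no_uniformly_consistent_estimator_def)
qed

section \<open>The family of tilted latent laws\<close>

text \<open>
  For \<open>1/2 \<le> h \<le> 1\<close> the tilted density has total mass \<open>1\<close> on \<open>[0, 1]\<close>, value \<open>h\<close> at \<open>0\<close>, and is at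
  least \<open>1/2\<close> on the whole half-line, so the edge weight stays in \<open>(0, 1/2]\<close>.
\<close>
definition tilt :: "real \<Rightarrow> real \<Rightarrow> real" where
  "tilt h s = h + 2 * (1 - h) * s"

text \<open>Built over the restricted Lebesgue measure so that its measurable sets are those of
  \<open>half_line\<close>, as \<open>law_kernel_pair\<close> demands.\<close>

definition latent :: "real \<Rightarrow> real measure" where
  "latent h = density (restrict_space lborel {0..}) (\<lambda>s. ennreal (tilt h s) * indicator {0..1} s)"

definition edge_weight :: "real \<Rightarrow> real \<Rightarrow> real" where
  "edge_weight h s = 1 / (4 * tilt h s)"

lemma measurable_tilt [measurable]: "tilt h \<in> borel_measurable borel"
  unfolding tilt_def by measurable

lemma measurable_edge_weight [measurable]: "edge_weight h \<in> borel_measurable borel"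
  unfolding edge_weight_def by measurable

lemma tilt_ge: "1/2 \<le> h \<Longrightarrow> h \<le> 1 \<Longrightarrow> 0 \<le> s \<Longrightarrow> 1/2 \<le> tilt h s"
  unfolding tilt_def by (smt (verit) mult_nonneg_nonneg)

lemma edge_weight_bounds:
  assumes "1/2 \<le> h" "h \<le> 1" "0 \<le> s"
  shows "0 < edge_weight h s" "edge_weight h s \<le> 1/2"
  using tilt_ge[OF assms] by (auto simp: edge_weight_def field_simps)

text \<open>Fundamental theorem of calculus, with \<open>k \<le> 1/2\<close> keeping the integrand
  nonnegative. The case \<open>k = 0\<close> gives the latent distribution function, and
  \<open>k = 1/4\<close> the mass that reaches the atom.\<close>

lemma nn_integral_tilt:
  assumes h: "1/2 \<le> h" "h \<le> 1" and k: "k \<le> 1/2" and t: "0 \<le> t"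
  shows "(\<integral>\<^sup>+s. ennreal (tilt h s - k) * indicator {0..t} s \<partial>lborel)
    = ennreal ((h - k) * t + (1 - h) * t^2)"
proof -
  have "(\<integral>\<^sup>+s. ennreal (tilt h s - k) * indicator {0..t} s \<partial>lborel)
      = ennreal (((h - k) * t + (1 - h) * t^2) - ((h - k) * 0 + (1 - h) * 0^2))"
  proof (rule nn_integral_FTC_Icc[where F="\<lambda>t. (h - k) * t + (1 - h) * t^2"])
    show "((\<lambda>t. (h - k) * t + (1 - h) * t^2) has_real_derivative tilt h x - k) (at x)" for x
      unfolding tilt_def by (auto intro!: derivative_eq_intros)
    show "0 \<le> tilt h x - k" if "x \<in> {0..t}" for x
      using tilt_ge[OF h, of x] that k by simp
  qed (use t in auto)
  then show ?thesis by simp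
qed

lemma sets_latent [measurable_cong]: "sets (latent h) = sets half_line"
  unfolding latent_def by (simp add: sets_restrict_space)

lemma measurable_latent_density:
  "(\<lambda>s. ennreal (tilt h s) * indicator {0..1} s) \<in> borel_measurable half_line"
  by (rule measurable_restrict_space1) measurable

text \<open>Moves integrals to Lebesgue measure on the whole line; the indicator of
  \<open>{0..1}\<close> absorbs that of \<open>{0..}\<close>.\<close>

lemma nn_integral_latent:
  assumes "\<phi> \<in> borel_measurable half_line"
  shows "(\<integral>\<^sup>+s. \<phi> s \<partial>latent h) = (\<integral>\<^sup>+s. ennreal (tilt h s) * indicator {0..1} s * \<phi> s \<partial>lborel)"
proof -
  have cong: "borel_measurable (restrict_space lborel {0..}) = borel_measurable half_line"
    by (rule measurable_cong_sets) (simp_all add: sets_restrict_space)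
  have "(\<integral>\<^sup>+s. \<phi> s \<partial>latent h)
      = (\<integral>\<^sup>+s. ennreal (tilt h s) * indicator {0..1} s * \<phi> s \<partial>restrict_space lborel {0..})"
    unfolding latent_def
    by (rule nn_integral_density) (simp_all add: measurable_latent_density cong assms)
  also have "\<dots> = (\<integral>\<^sup>+s. ennreal (tilt h s) * indicator {0..1} s * \<phi> s * indicator {0..} s \<partial>lborel)"
    by (rule nn_integral_restrict_space) auto
  also have "\<dots> = (\<integral>\<^sup>+s. ennreal (tilt h s) * indicator {0..1} s * \<phi> s \<partial>lborel)"
    by (rule nn_integral_cong) (auto simp: indicator_def)
  finally show ?thesis .
qed

lemma emeasure_latent:
  assumes "B \<in> sets borel" "B \<subseteq> {0..}"
  shows "emeasure (latent h) B = (\<integral>\<^sup>+s. ennreal (tilt h s) * indicator (B \<inter> {0..1}) s \<partial>lborel)"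
proof -
  have B: "B \<in> sets half_line"
    using assms by (auto simp: sets_restrict_space_iff)
  then have "emeasure (latent h) B = (\<integral>\<^sup>+s. indicator B s \<partial>latent h)"
    by (simp add: sets_latent)
  also have "\<dots> = (\<integral>\<^sup>+s. ennreal (tilt h s) * indicator {0..1} s * indicator B s \<partial>lborel)"
    by (rule nn_integral_latent) (use B in simp)
  also have "\<dots> = (\<integral>\<^sup>+s. ennreal (tilt h s) * indicator (B \<inter> {0..1}) s \<partial>lborel)"
    by (rule nn_integral_cong) (auto simp: indicator_def)
  finally show ?thesis .
qed

lemma emeasure_latent_Icc:
  assumes "1/2 \<le> h" "h \<le> 1" "0 \<le> t" "t \<le> 1"
  shows "emeasure (latent h) {0..t} = ennreal (h * t + (1 - h) * t^2)"
proof -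
  have "{0..t} \<inter> {0..1} = {0..t}" using assms by auto
  then show ?thesis
    using nn_integral_tilt[of h 0 t] assms by (simp add: emeasure_latent)
qed

text \<open>The density of \<open>latent h\<close> vanishes off \<open>{0..1}\<close>, so Lebesgue
  null sets and all points outside this interval are negligible.\<close>

lemma AE_latent:
  assumes "AE s in lborel. s \<in> {0..1} \<longrightarrow> P s"
  shows "AE s in latent h. P s"
proof -
  have "AE s in restrict_space lborel {0..}. s \<in> {0..1} \<longrightarrow> P s"
    using assms by (subst AE_restrict_space_iff) (auto elim: eventually_mono)
  then have "AE s in restrict_space lborel {0..}. 0 < ennreal (tilt h s) * indicator {0..1} s \<longrightarrow> P s"
    by eventually_elim (simp add: indicator_def split: if_splits)
  moreover have "(\<lambda>s. ennreal (tilt h s) * indicator {0..1} s) \<in> borel_measurable (restrict_space lborel {0..})"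
    by (rule measurable_restrict_space1) measurable
  ultimately show ?thesis
    unfolding latent_def by (simp add: AE_density)
qed

lemma prob_space_latent:
  assumes "1/2 \<le> h" "h \<le> 1"
  shows "prob_space (latent h)"
proof
  have "space (latent h) = {0..}" by (simp add: latent_def space_restrict_space)
  moreover have "emeasure (latent h) {0..} = emeasure (latent h) {0..1}"
  proof -
    have "{0..} \<inter> {0..1::real} = {0..1}" by auto
    then show ?thesis by (simp add: emeasure_latent)
  qed
  ultimately show "emeasure (latent h) (space (latent h)) = 1"
    using emeasure_latent_Icc[of h 1] assms by simp
qed

section \<open>Equality of the observed laws\<close>

lemma law_kernel_pair_latent:
  assumes "1/2 \<le> h" "h \<le> 1"
  shows "law_kernel_pair (latent h) (kern (edge_weight h))"
  unfolding law_kernel_pair_def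
proof (intro conjI allI impI)
  show "latent h \<in> space (prob_algebra half_line)"
    using prob_space_latent[OF assms] by (simp add: space_prob_algebra sets_latent)
  show "kern (edge_weight h) \<in> half_line \<rightarrow>\<^sub>M prob_algebra borel"
    by (rule measurable_kern) measurable
  show "0 < emeasure (kern (edge_weight h) s) {..<\<top>}" if "0 \<le> s" for s
    using edge_weight_bounds[OF assms that] that by (intro emeasure_kern_top_finite) auto
qed

text \<open>The point is that \<open>h\<close> has left the right-hand side: on
  \<open>[0, 1]\<close> the density times the edge weight is 1/4, and the atom receives the
  remaining density \<open>tilt h s - 1/4\<close>.\<close>

lemma emeasure_observed_latent:
  assumes h: "1/2 \<le> h" "h \<le> 1" and B [measurable]: "B \<in> sets borel"
  shows "emeasure (observed_law (latent h) (kern (edge_weight h))) B =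
    (\<integral>\<^sup>+s. ennreal (1/4) * indicator {0..1} s *
       (\<integral>\<^sup>+x. indicator {0..1} x * indicator B (ennreal (s + x)) \<partial>lborel) \<partial>lborel)
    + ennreal (3/4) * indicator B 3"
proof -
  let ?c = "edge_weight h"
  define A where "A s = (\<integral>\<^sup>+x. indicator {0..1} x * indicator B (ennreal (s + x)) \<partial>lborel)" for s
  have [measurable]: "A \<in> borel_measurable borel"
    unfolding A_def by measurable
  have "emeasure (observed_law (latent h) (kern ?c)) B = (\<integral>\<^sup>+s. emeasure (kern ?c s) B \<partial>latent h)"
    by (rule observed_law_properties(3)[OF law_kernel_pair_latent[OF h] B])
  also have "\<dots> = (\<integral>\<^sup>+s. ennreal (tilt h s) * indicator {0..1} s * emeasure (kern ?c s) B \<partial>lborel)"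
    by (rule nn_integral_latent)
       (rule measurable_compose[OF measurable_prob_algebraD[OF measurable_kern]
          measurable_emeasure_subprob_algebra]; measurable)
  also have "\<dots> = (\<integral>\<^sup>+s. ennreal (1/4) * indicator {0..1} s * A s
      + (ennreal (tilt h s - 1/4) * indicator {0..1} s) * indicator B 3 \<partial>lborel)"
  proof (rule nn_integral_cong)
    fix s :: real
    show "ennreal (tilt h s) * indicator {0..1} s * emeasure (kern ?c s) B
        = ennreal (1/4) * indicator {0..1} s * A s
          + (ennreal (tilt h s - 1/4) * indicator {0..1} s) * indicator B 3"
    proof (cases "s \<in> {0..1}")
      case True
      note c = edge_weight_bounds[OF h, of s] and t = tilt_ge[OF h, of s]
      have "ennreal (tilt h s) * ennreal (?c s) = ennreal (1/4)"
        using t c True by (subst ennreal_mult[symmetric]) (auto simp: edge_weight_def)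
      moreover have "ennreal (tilt h s) * ennreal (1 - ?c s) = ennreal (tilt h s - 1/4)"
        using t c True by (subst ennreal_mult[symmetric]) (auto simp: edge_weight_def field_simps)
      \<comment> \<open>For all \<open>s\<close> charged by \<open>latent h\<close> the atom sits at
        the same point, so the remaining masses merge there.\<close>
      moreover have "max 3 (s + 2) = 3" using True by simp
      ultimately show ?thesis
        using True c by (subst emeasure_kern)
          (auto simp: A_def[symmetric] distrib_left mult.assoc[symmetric])
    qed simp
  qed
  also have "\<dots> = (\<integral>\<^sup>+s. ennreal (1/4) * indicator {0..1} s * A s \<partial>lborel)
      + (\<integral>\<^sup>+s. (ennreal (tilt h s - 1/4) * indicator {0..1} s) * indicator B 3 \<partial>lborel)"
    by (rule nn_integral_add) measurable
  \<comment> \<open>Total latent mass 1 less the 1/4 carried by the uniform parts, whatever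
    \<open>h\<close> is.\<close>
  also have "(\<integral>\<^sup>+s. (ennreal (tilt h s - 1/4) * indicator {0..1} s) * indicator B 3 \<partial>lborel)
      = ennreal (3/4) * indicator B 3"
    by (subst nn_integral_multc) (use nn_integral_tilt[OF h, of "1/4" 1] in auto)
  finally show ?thesis unfolding A_def .
qed

lemma observed_latent_eq:
  assumes "1/2 \<le> h" "h \<le> 1" "1/2 \<le> h'" "h' \<le> 1"
  shows "observed_law (latent h) (kern (edge_weight h)) = observed_law (latent h') (kern (edge_weight h'))"
proof (rule measure_eqI)
  note sets = observed_law_properties(2)[OF law_kernel_pair_latent]
  show "sets (observed_law (latent h) (kern (edge_weight h)))
      = sets (observed_law (latent h') (kern (edge_weight h')))"
    using sets assms by simp
  fix B assume "B \<in> sets (observed_law (latent h) (kern (edge_weight h)))"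
  then have "B \<in> sets borel" using sets assms by simp
  then show "emeasure (observed_law (latent h) (kern (edge_weight h))) B
      = emeasure (observed_law (latent h') (kern (edge_weight h'))) B"
    using assms by (simp add: emeasure_observed_latent)
qed

section \<open>Membership in the regular class\<close>

text \<open>The continuous version \<open>tilt h\<close> has the positive limit \<open>h\<close> at
  0, so the exponent is 0 and the tilt shows up in the leading constant.\<close>

lemma density_near_0_latent:
  assumes "1/2 \<le> h" "h \<le> 1"
  shows "density_near_0 (latent h) 1 0 h"
  unfolding density_near_0_def
proof (intro exI[of _ "tilt h"] conjI ballI impI)
  show "tilt h \<in> borel_measurable (restrict_space borel {0<..<1})"
    by (rule measurable_restrict_space1) measurable
  show "0 \<le> tilt h s" if "s \<in> {0<..<1}" for s
    using tilt_ge[OF assms, of s] that by simp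
  show "emeasure (latent h) B = (\<integral>\<^sup>+s. ennreal (tilt h s) * indicator B s \<partial>lborel)"
    if B: "B \<in> sets borel" "B \<subseteq> {0<..<1}" for B
  proof -
    have "B \<inter> {0..1} = B" "B \<subseteq> {0..}" using B(2) by auto
    then show ?thesis by (simp add: emeasure_latent B(1))
  qed
  \<comment> \<open>The factor \<open>s powr 0\<close> is inserted afterwards: it is 1 for
    \<open>s > 0\<close> although \<open>0 powr 0 = 0\<close>, and \<open>at_right 0\<close> sees
    only positive \<open>s\<close>.\<close>
  have "((\<lambda>s. tilt h s / h) \<longlongrightarrow> (h + 2 * (1 - h) * 0) / h) (at_right 0)"
    unfolding tilt_def by (intro tendsto_intros) (use assms in auto)
  then have "((\<lambda>s. tilt h s / h) \<longlongrightarrow> 1) (at_right 0)" using assms by simp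
  then show "((\<lambda>s. tilt h s / (h * s powr 0)) \<longlongrightarrow> 1) (at_right 0)"
    by (rule Lim_transform_eventually) (rule eventually_mono[OF eventually_at_right_less[of 0]], simp)
qed

lemma axiom_NA_latent:
  assumes h: "1/2 \<le> h" "h \<le> 1"
  shows "axiom_NA (latent h) (kern (edge_weight h))"
  unfolding axiom_NA_def
  \<comment> \<open>Shifted back by \<open>s\<close>, the atom at \<open>3\<close> would give \<open>\<mu>\<close> an atom at \<open>3 - s\<close> for almost every \<open>s\<close>.\<close>
proof
  let ?c = "edge_weight h"
  assume "\<exists>\<mu>\<in>space (prob_algebra borel). AE s in latent h. emeasure (kern ?c s) {\<top>} = 0 \<and>
    (\<forall>B\<in>sets borel. B \<subseteq> {0..} \<longrightarrow> emeasure (kern ?c s) (ennreal ` B) = emeasure \<mu> ((\<lambda>x. x - s) ` B))"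
  then obtain \<mu> where \<mu>: "\<mu> \<in> space (prob_algebra (borel :: real measure))"
    and ae: "AE s in latent h. \<forall>B\<in>sets borel. B \<subseteq> {0..} \<longrightarrow>
      emeasure (kern ?c s) (ennreal ` B) = emeasure \<mu> ((\<lambda>x. x - s) ` B)"
    by (auto elim!: eventually_mono)
  interpret \<mu>: prob_space \<mu> using \<mu> by (simp add: space_prob_algebra)
  \<comment> \<open>A probability measure has only countably many atoms, so \<open>D\<close>, the
    set of \<open>s\<close> for which \<open>3 - s\<close> is an atom of \<mu>, is Lebesgue
    null.\<close>
  define D where "D = (\<lambda>x. 3 - x) ` {x. measure \<mu> {x} \<noteq> 0}"
  have D: "countable D" unfolding D_def by (intro countable_image \<mu>.countable_support)
  have "AE s in lborel. s \<notin> D"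
    using emeasure_lborel_countable[OF D] D
    by (intro AE_I[of _ _ D]) (auto intro: sets.countable)
  then have "AE s in latent h. s \<in> {0..1} \<and> s \<notin> D"
    by (intro AE_latent) (auto elim: eventually_mono)
  with ae have "AE s in latent h. False"
  proof eventually_elim
    case (elim s)
    then have s: "s \<in> {0..1}" "s \<notin> D" by auto
    note c = edge_weight_bounds[OF h, of s]
    have "emeasure \<mu> {3 - s} = emeasure (kern ?c s) {ennreal 3}"
      using elim(1)[rule_format, of "{3}"] by simp
    also have "\<dots> \<noteq> 0"
      using s c by (subst emeasure_kern) (auto simp: max_def)
    finally have "3 - s \<in> {x. measure \<mu> {x} \<noteq> 0}"
      by (simp add: \<mu>.emeasure_eq_measure)
    then have "s \<in> D" unfolding D_def by (intro image_eqI[of _ _ "3 - s"]) auto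
    with s show False by simp
  qed
  then show False using prob_space.AE_False[OF prob_space_latent[OF h]] by simp
qed

text \<open>The lower edge is \<open>s\<close> itself, hence both slope constants are 1. The
  midpoint shift stays in \<open>[1, 3/2]\<close>, below the bound 2, because the upper edge moves
  on as \<open>s + 2\<close> beyond \<open>s = 1\<close>.\<close>

lemma latent_in_M_reg:
  assumes h: "1/2 \<le> h" "h \<le> 1"
  shows "(latent h, kern (edge_weight h)) \<in> M_reg 0 2 1 1 (1/2) 1 1 1"
proof -
  let ?K = "kern (edge_weight h)"
  note c = edge_weight_bounds[OF h]
  have lo: "lower_edge ?K s = ennreal s" and up: "upper_edge ?K s = ennreal (max 3 (s + 2))"
    if "0 \<le> s" for s
    using kern_edges[of "edge_weight h" s] c[OF that] that by auto
  have ell: "ell ?K s = s" if "0 \<le> s" for s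
    using that by (simp add: ell_def lo)
  have width: "width ?K s = ennreal (max 3 (s + 2) - s)" if "0 \<le> s" for s
    using that by (simp add: width_def lo up ennreal_minus)
  have mid: "mid_shift ?K s = (max 3 (s + 2) - s) / 2" if "0 \<le> s" for s
    using that by (simp add: mid_shift_def lo up field_simps)
  have "axiom_A1 1 (latent h)"
    unfolding axiom_A1_def
    using density_near_0_latent[OF h] emeasure_latent_Icc[of h 0] h
    by (intro conjI exI[of _ 1] exI[of _ h] exI[of _ 0]) auto
  moreover have "axiom_A2 1 ?K"
    unfolding axiom_A2_def
    using c by (auto simp: width intro!: emeasure_kern_top_finite(1) order_trans[OF c(2)])
  moreover have "axiom_A3 2 ?K"
    unfolding axiom_A3_def by (auto simp: mid intro!: exI[of _ 0])
  moreover have "axiom_A4 ?K"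
    unfolding axiom_A4_def
  proof -
    \<comment> \<open>The width is at least 2 for every \<open>s \<ge> 0\<close>, so
      \<open>2 / s\<close> minorises the ratio.\<close>
    have "filterlim (\<lambda>s::real. 2 / s) at_top (at_right 0)" by real_asymp
    then have lim: "((\<lambda>s::real. ennreal (2 / s)) \<longlongrightarrow> \<top>) (at_right 0)"
      by (rule iffD2[OF ennreal_tendsto_top_eq_at_top])
    show "((\<lambda>s. width ?K s / ennreal s) \<longlongrightarrow> \<top>) (at_right 0)"
    proof (rule tendsto_sandwich[OF _ _ lim tendsto_const])
      show "\<forall>\<^sub>F s in at_right 0. ennreal (2 / s) \<le> width ?K s / ennreal s"
        using eventually_at_right_less[of 0]
        by eventually_elim (auto simp: width divide_ennreal intro!: ennreal_leI divide_right_mono)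
    qed auto
  qed
  moreover have "axiom_A5 1 1 1 ?K"
  proof -
    have lim: "(ell ?K \<longlongrightarrow> 0) (at_right 0)"
      by (rule Lim_transform_eventually[OF tendsto_ident_at])
         (rule eventually_mono[OF eventually_at_right_less[of 0]], simp add: ell)
    show ?thesis
      unfolding axiom_A5_def Let_def using lim
      by (intro exI[of _ 0]) (auto simp: ell mono_on_def)
  qed
  moreover have "axiom_A6 0 1 ?K"
    unfolding axiom_A6_def
  proof (intro exI[of _ "edge_weight h"] conjI ballI allI impI)
    show "0 < edge_weight h s" if "s \<in> {0<..1}" for s using c that by simp
    have "(edge_weight h \<longlongrightarrow> 1 / (4 * (h + 2 * (1 - h) * 0))) (at_right 0)"
      unfolding edge_weight_def tilt_def by (intro tendsto_intros) (use h in auto)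
    then have "((\<lambda>s. ereal (edge_weight h s)) \<longlongrightarrow> ereal (1 / (4 * h))) (at_right 0)" by simp
    from lim_imp_Liminf[OF _ this] lim_imp_Limsup[OF _ this]
    show "0 < Liminf (at_right 0) (\<lambda>s. ereal (edge_weight h s))"
      "Limsup (at_right 0) (\<lambda>s. ereal (edge_weight h s)) < \<infinity>"
      using h by simp_all
    fix \<epsilon> :: real assume \<epsilon>: "\<epsilon> > 0"
    \<comment> \<open>The growth is exactly linear up to \<open>\<delta> = 1\<close>, so
      \<open>\<eta> = 1\<close> serves every \<epsilon>.\<close>
    have "measure (?K s) {ennreal (ell ?K s)..ennreal (ell ?K s + \<delta>)} = edge_weight h s * \<delta>"
      if "s \<in> {0<..1}" "\<delta> \<in> {0<..1}" for s \<delta>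
      using emeasure_kern_initial[of "edge_weight h" s \<delta>] c[of s] that by (simp add: ell measure_def)
    moreover have "(1 - \<epsilon>) * edge_weight h s * \<delta> \<le> edge_weight h s * \<delta> \<and>
        edge_weight h s * \<delta> \<le> (1 + \<epsilon>) * edge_weight h s * \<delta>"
      if "s \<in> {0<..1}" "\<delta> \<in> {0<..1}" for s \<delta>
      using c[of s] that \<epsilon> by (auto intro!: mult_right_mono simp: algebra_simps)
    ultimately show "\<exists>\<eta>>0. \<forall>s\<in>{0<..1}. \<forall>\<delta>\<in>{0<..\<eta>}.
        (1 - \<epsilon>) * edge_weight h s * \<delta> powr (0 + 1)
          \<le> measure (?K s) {ennreal (ell ?K s)..ennreal (ell ?K s + \<delta>)} \<and>
        measure (?K s) {ennreal (ell ?K s)..ennreal (ell ?K s + \<delta>)}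
          \<le> (1 + \<epsilon>) * edge_weight h s * \<delta> powr (0 + 1)"
      by (intro exI[of _ 1]) auto
  qed
  ultimately show ?thesis
    using law_kernel_pair_latent[OF h] axiom_NA_latent[OF h] by (simp add: M_reg_def)
qed

section \<open>Two members with the same observed law\<close>

theorem theorem4p5:
  shows "\<exists>\<beta> b cm cp \<tau> sbar sR sA.
    admissible_constants \<beta> b cm cp \<tau> sbar sR sA \<and>
    (\<exists>F K F' K'.
       (F, K) \<in> M_reg \<beta> b cm cp \<tau> sbar sR sA \<and>
       (F', K') \<in> M_reg \<beta> b cm cp \<tau> sbar sR sA \<and>
       observed_law F K = observed_law F' K' \<and>
       alpha_of F' = alpha_of F \<and> L_of F' \<noteq> L_of F \<and> p_tau \<tau> F' \<noteq> p_tau \<tau> F) \<and>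
    \<not> identifiable (M_reg \<beta> b cm cp \<tau> sbar sR sA) (\<lambda>(F, K). L_of F) \<and>
    \<not> identifiable (M_reg \<beta> b cm cp \<tau> sbar sR sA) (\<lambda>(F, K). p_tau \<tau> F) \<and>
    no_uniformly_consistent_estimator (M_reg \<beta> b cm cp \<tau> sbar sR sA) (\<lambda>(F, K). L_of F) \<and>
    no_uniformly_consistent_estimator (M_reg \<beta> b cm cp \<tau> sbar sR sA) (\<lambda>(F, K). p_tau \<tau> F)"
proof -
  let ?N = "M_reg 0 2 1 1 (1/2) 1 1 1"
  let ?K = "\<lambda>h. kern (edge_weight h)"
  \<comment> \<open>The two ends of the admissible range of \<open>h\<close>: the uniform density on
    \<open>[0, 1]\<close> and the density \<open>1/2 + s\<close>.\<close>
  have mem: "(latent 1, ?K 1) \<in> ?N" "(latent (1/2), ?K (1/2)) \<in> ?N"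
    by (rule latent_in_M_reg; simp)+
  have obs: "observed_law (latent 1) (?K 1) = observed_law (latent (1/2)) (?K (1/2))"
    by (rule observed_latent_eq) auto
  have par: "alpha_of (latent h) = 0" "L_of (latent h) = h" if "1/2 \<le> h" "h \<le> 1" for h
    using leading_params_eq[OF density_near_0_latent[OF that]] that by auto
  \<comment> \<open>The tilt preserves the total mass but not the mass of \<open>[0, 1/2]\<close>,
    so \<open>\<tau> = 1/2\<close> separates the members.\<close>
  have p: "p_tau (1/2) (latent h) = 1/4 + h/4" if "1/2 \<le> h" "h \<le> 1" for h
    using emeasure_latent_Icc[of h "1/2"] that
    by (simp add: p_tau_def measure_def power2_eq_square field_simps)
  have L: "L_of (latent 1) \<noteq> L_of (latent (1/2))" and pne: "p_tau (1/2) (latent 1) \<noteq> p_tau (1/2) (latent (1/2))"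
    by (simp_all add: par p)
  \<comment> \<open>Kept general in \<phi> so that \<open>L_of\<close> and \<open>p_tau\<close>
    share one argument.\<close>
  have unid: "\<not> identifiable ?N \<phi> \<and> no_uniformly_consistent_estimator ?N \<phi>"
    if ne: "\<phi> (latent 1, ?K 1) \<noteq> \<phi> (latent (1/2), ?K (1/2))" for \<phi>
  proof
    show "\<not> identifiable ?N \<phi>"
      unfolding identifiable_def using mem obs ne by blast
    show "no_uniformly_consistent_estimator ?N \<phi>"
      by (rule two_point_no_estimator[where \<phi>=\<phi>, OF mem law_kernel_pair_latent obs ne]) auto
  qed
  have adm: "admissible_constants 0 2 1 1 (1/2) 1 1 1"
    by (simp add: admissible_constants_def)
  have \<alpha>: "alpha_of (latent (1/2)) = alpha_of (latent 1)" by (simp add: par)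
  have "\<exists>F K F' K'. (F, K) \<in> ?N \<and> (F', K') \<in> ?N \<and> observed_law F K = observed_law F' K' \<and>
      alpha_of F' = alpha_of F \<and> L_of F' \<noteq> L_of F \<and> p_tau (1/2) F' \<noteq> p_tau (1/2) F"
    by (rule exI[of _ "latent 1"], rule exI[of _ "?K 1"], rule exI[of _ "latent (1/2)"],
        rule exI[of _ "?K (1/2)"]) (intro conjI mem obs \<alpha> L[symmetric] pne[symmetric])
  moreover have "\<not> identifiable ?N (\<lambda>(F, K). L_of F) \<and>
      no_uniformly_consistent_estimator ?N (\<lambda>(F, K). L_of F)"
    by (rule unid) (use L in simp)
  moreover have "\<not> identifiable ?N (\<lambda>(F, K). p_tau (1/2) F) \<and>
      no_uniformly_consistent_estimator ?N (\<lambda>(F, K). p_tau (1/2) F)"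
    by (rule unid) (use pne in simp)
  ultimately show ?thesis
    using adm by blast
qed

end
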